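(* For any $\delta\in(0,1]$, any $\epsilon>0$, any number of bettors $n>0$, any strictly proper scoring rule $s:[0,1]\times\{0,1\}\to[0,1]$, any outcome $\omega\in\{0,1\}$, and any vectors of reports $\mathbf p\in[0,1]^n$ and wagers $\mathbf m\in\mathbb R_+^n$ with $\mathbf m\ne 0$, with probability at least $1-\delta$, for all $i\in\{1,\dots,n\}$ simultaneously, the profit $\Pi_i$ output by the private wagering mechanism satisfies $$\left|\Pi_i(\mathbf p,\mathbf m,\omega)-\mathbb E[\Pi_i(\mathbf p,\mathbf m,\omega)]\right|\le m_i\left(\frac{\|\mathbf m\|_2}{\|\mathbf m\|_1}(1+\beta)\sqrt{\frac{\ln(2/\delta)}{2}}\right),$$ where $\beta=e^{-\epsilon}$.
   Context: $\mathbb R_+=[0,\infty)$. A function $s$ is a strictly proper scoring rule if for all $p\ne q$ in $[0,1]$, $\mathbb E_{\omega\sim p}[s(p,\omega)]>\mathbb E_{\omega\sim p}[s(q,\omega)]$, where $\omega\sim p$ means $\Pr[\omega=1]=p$. Private wagering mechanism with parameters $n,\epsilon,s$: let $\alpha=1-e^{-\epsilon}$, $\beta=e^{-\epsilon}$. Given reports $\mathbf p=(p_1,\dots,p_n)$, wagers $\mathbf m=(m_1,\dots,m_n)$ and outcome $\omega$, draw independently for each $i$ a random variable $x_i(p_i,\omega)$ equal to $1$ with probability $\frac{\alpha s(p_i,\omega)+\beta}{1+\beta}$ and equal to $-\beta$ with probability $\frac{1-\alpha s(p_i,\omega)}{1+\beta}$. The profit of bettor $i$ is $$\Pi_i(\mathbf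 p,\mathbf m,\omega)=m_i\left(\alpha s(p_i,\omega)-\frac{\sum_{j=1}^nm_jx_j(p_j,\omega)}{\sum_{j=1}^nm_j}\right).$$ Probability and expectation are over the draws of the $x_j(p_j,\omega)$. $\|\cdot\|_1,\|\cdot\|_2$ are the $\ell_1$ and $\ell_2$ norms. *)

theory Defs
  imports "HOL-Probability.Probability"
begin

text \<open>
  Outcomes are the natural numbers 0 and 1, and a scoring rule is a function s of a report p and
  an outcome; only its values on the unit interval times {0, 1} matter. Reports and wagers of n
  bettors are functions on the naturals, of which only the values on {1..n} matter.
\<close>

definition outcome_pmf :: "real \<Rightarrow> nat pmf" where
  "outcome_pmf p = map_pmf of_bool (bernoulli_pmf p)"

definition strictly_proper :: "(real \<Rightarrow> nat \<Rightarrow> real) \<Rightarrow> bool" where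
  "strictly_proper s \<longleftrightarrow>
     (\<forall>p\<in>{0..1}. \<forall>q\<in>{0..1}. p \<noteq> q \<longrightarrow>
        measure_pmf.expectation (outcome_pmf p) (s p) >
        measure_pmf.expectation (outcome_pmf p) (s q))"

definition mech_alpha :: "real \<Rightarrow> real" where
  "mech_alpha \<epsilon> = 1 - exp (- \<epsilon>)"

definition mech_beta :: "real \<Rightarrow> real" where
  "mech_beta \<epsilon> = exp (- \<epsilon>)"

text \<open>
  The argument of \<open>bernoulli_pmf\<close> below lies in the unit interval whenever the score does, so the
  clamping built into \<open>bernoulli_pmf\<close> has no effect; see \<open>pmf_noise_pmf\<close>.
\<close>

definition noise_pmf ::
  "real \<Rightarrow> (real \<Rightarrow> nat \<Rightarrow> real) \<Rightarrow> real \<Rightarrow> nat \<Rightarrow> real pmf" where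
  "noise_pmf \<epsilon> s p \<omega> =
     map_pmf (\<lambda>b. if b then 1 else - mech_beta \<epsilon>)
       (bernoulli_pmf ((mech_alpha \<epsilon> * s p \<omega> + mech_beta \<epsilon>) / (1 + mech_beta \<epsilon>)))"

definition profit ::
  "nat \<Rightarrow> real \<Rightarrow> (real \<Rightarrow> nat \<Rightarrow> real) \<Rightarrow> (nat \<Rightarrow> real) \<Rightarrow> (nat \<Rightarrow> real) \<Rightarrow> nat \<Rightarrow>
   (nat \<Rightarrow> real) \<Rightarrow> nat \<Rightarrow> real" where
  "profit n \<epsilon> s p m \<omega> x i =
     m i * (mech_alpha \<epsilon> * s (p i) \<omega> - (\<Sum>j=1..n. m j * x j) / (\<Sum>j=1..n. m j))"

text \<open>
  The joint distribution of the profits of all bettors: \<open>Pi_pmf\<close> draws the components with index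
  in {1..n} independently (and puts 0 outside this set).
\<close>

definition private_wagering ::
  "nat \<Rightarrow> real \<Rightarrow> (real \<Rightarrow> nat \<Rightarrow> real) \<Rightarrow> (nat \<Rightarrow> real) \<Rightarrow> (nat \<Rightarrow> real) \<Rightarrow> nat \<Rightarrow>
   (nat \<Rightarrow> real) pmf" where
  "private_wagering n \<epsilon> s p m \<omega> =
     map_pmf (profit n \<epsilon> s p m \<omega>) (Pi_pmf {1..n} 0 (\<lambda>j. noise_pmf \<epsilon> s (p j) \<omega>))"

lemma pmf_noise_pmf:
  assumes "\<epsilon> > 0" and "s p \<omega> \<in> {0..1}"
  shows "pmf (noise_pmf \<epsilon> s p \<omega>) 1 =
           (mech_alpha \<epsilon> * s p \<omega> + mech_beta \<epsilon>) / (1 + mech_beta \<epsilon>)"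
    and "pmf (noise_pmf \<epsilon> s p \<omega>) (- mech_beta \<epsilon>) =
           (1 - mech_alpha \<epsilon> * s p \<omega>) / (1 + mech_beta \<epsilon>)"
proof -
  have b: "0 < mech_beta \<epsilon>" and a: "0 < mech_alpha \<epsilon>" "mech_alpha \<epsilon> < 1"
    using assms(1) by (auto simp: mech_alpha_def mech_beta_def)
  define r where "r = (mech_alpha \<epsilon> * s p \<omega> + mech_beta \<epsilon>) / (1 + mech_beta \<epsilon>)"
  have "mech_alpha \<epsilon> * s p \<omega> \<le> 1 * 1"
    by (rule mult_mono) (use a assms(2) in auto)
  moreover have "mech_alpha \<epsilon> * s p \<omega> \<ge> 0"
    using a assms(2) by auto
  ultimately have r: "0 \<le> r" "r \<le> 1"
    using b by (auto simp: r_def field_simps)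
  let ?f = "\<lambda>b. if b then 1 else - mech_beta \<epsilon>"
  have inj: "inj ?f"
    using b by (auto simp: inj_def)
  have noise: "noise_pmf \<epsilon> s p \<omega> = map_pmf ?f (bernoulli_pmf r)"
    by (simp add: noise_pmf_def r_def)
  have "pmf (noise_pmf \<epsilon> s p \<omega>) 1 = r"
    using pmf_map_inj'[OF inj, of "bernoulli_pmf r" True] r by (simp add: noise)
  then show "pmf (noise_pmf \<epsilon> s p \<omega>) 1 =
      (mech_alpha \<epsilon> * s p \<omega> + mech_beta \<epsilon>) / (1 + mech_beta \<epsilon>)"
    by (simp add: r_def)
  have "pmf (noise_pmf \<epsilon> s p \<omega>) (- mech_beta \<epsilon>) = 1 - r"
    using pmf_map_inj'[OF inj, of "bernoulli_pmf r" False] r by (simp add: noise)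
  also have "\<dots> = (1 - mech_alpha \<epsilon> * s p \<omega>) / (1 + mech_beta \<epsilon>)"
    using b by (simp add: r_def field_simps)
  finally show "pmf (noise_pmf \<epsilon> s p \<omega>) (- mech_beta \<epsilon>) =
      (1 - mech_alpha \<epsilon> * s p \<omega>) / (1 + mech_beta \<epsilon>)" .
qed

end

theory Submission
  imports Defs
begin

text \<open>
  Every profit depends on the random draws only through the weighted sum of the noise variables, so
  all the deviations are bounded at once on the single event that this sum is close to its mean,
  whose probability Hoeffding's inequality controls.
\<close>

text \<open>Each summand \<open>w i * x i\<close> ranges over an interval of length
  \<open>w i * (b - a)\<close>, so the sum of squared lengths in Hoeffding's inequality is the
  square of \<open>L2_set w I * (b - a)\<close>. The radius is the one at which the two-sided tail
  bound equals \<delta>. Integrability is stated as well because the mean of a profit is later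
  computed by linearity.\<close>

lemma Hoeffding_weighted_Pi_pmf:
  fixes q :: "'a \<Rightarrow> real pmf" and w :: "'a \<Rightarrow> real" and d :: real
  assumes "finite I" and supp: "\<And>i. i \<in> I \<Longrightarrow> set_pmf (q i) \<subseteq> {a..b}"
    and w: "\<And>i. i \<in> I \<Longrightarrow> w i \<ge> 0" and "L2_set w I > 0" and "a < b"
    and \<delta>: "0 < \<delta>" "\<delta> \<le> 1"
  defines "P \<equiv> Pi_pmf I d q" and "S \<equiv> \<lambda>x. \<Sum>i\<in>I. w i * x i"
  shows "integrable (measure_pmf P) S"
    and "measure_pmf.prob P {x. \<bar>S x - measure_pmf.expectation P S\<bar>
           \<le> L2_set w I * (b - a) * sqrt (ln (2 / \<delta>) / 2)} \<ge> 1 - \<delta>"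
proof -
  \<comment> \<open>The centre is given here as a sum of expectations; \<open>mean\<close> below
    identifies it with the expectation of \<open>S\<close>. Nonnegative weights keep the interval
    endpoints in order.\<close>
  interpret Hoeffding_ineq "measure_pmf P" I "\<lambda>i x. w i * x i" "\<lambda>i. w i * a" "\<lambda>i. w i * b"
    "\<Sum>i\<in>I. measure_pmf.expectation P (\<lambda>x. w i * x i)"
  proof unfold_locales
    show "prob_space.indep_vars (measure_pmf P) (\<lambda>_. borel) (\<lambda>i x. w i * x i) I"
      using prob_space.indep_vars_compose2[OF prob_space_measure_pmf indep_vars_Pi_pmf[OF \<open>finite I\<close>],
          where Y = "\<lambda>i y. w i * y" and N = "\<lambda>_. borel"]
      by (simp add: P_def)
    show "AE x in measure_pmf P. w i * x i \<in> {w i * a..w i * b}" if i: "i \<in> I" for i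
    proof (rule AE_pmfI)
      fix x assume "x \<in> set_pmf P"
      then have "x i \<in> set_pmf (q i)"
        using i \<open>finite I\<close> by (auto simp: P_def set_Pi_pmf PiE_dflt_def)
      then show "w i * x i \<in> {w i * a..w i * b}"
        using supp[OF i] w[OF i] by (auto intro!: mult_left_mono)
    qed
  qed (use \<open>finite I\<close> in auto)
  have int: "integrable (measure_pmf P) (\<lambda>x. w i * x i)" if "i \<in> I" for i
    by (rule interval_bounded_random_variable.integrable[OF bounded_random_variable[OF that]])
  show "integrable (measure_pmf P) S"
    unfolding S_def by (intro Bochner_Integration.integrable_sum int)
  have mean: "measure_pmf.expectation P S = (\<Sum>i\<in>I. measure_pmf.expectation P (\<lambda>x. w i * x i))"
    unfolding S_def by (intro Bochner_Integration.integral_sum int)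
  \<comment> \<open>This \<open>t\<close> solves \<open>2 * exp (- 2 * t^2 / D) = \<delta>\<close>,
    where \<open>D\<close> is the sum of squared interval lengths computed in \<open>D\<close>
    below.\<close>
  define t where "t = L2_set w I * (b - a) * sqrt (ln (2 / \<delta>) / 2)"
  \<comment> \<open>Nonnegativity lets squaring undo the square root in \<open>t\<close>.\<close>
  have l: "ln (2 / \<delta>) \<ge> 0"
    using \<delta> by (intro ln_ge_zero) (simp add: field_simps)
  have D: "(\<Sum>i\<in>I. (w i * b - w i * a)\<^sup>2) = (L2_set w I * (b - a))\<^sup>2"
    by (simp add: L2_set_def power_mult_distrib sum_distrib_right sum_nonneg
        flip: right_diff_distrib)
  have pos: "L2_set w I * (b - a) > 0"
    using assms by simp
  have t0: "t \<ge> 0"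
    using assms(4,5) l by (simp add: t_def)
  have t2: "t\<^sup>2 = (L2_set w I * (b - a))\<^sup>2 * (ln (2 / \<delta>) / 2)"
    using l by (simp add: t_def power_mult_distrib)
  have "measure_pmf.prob P {x. \<bar>S x - measure_pmf.expectation P S\<bar> \<ge> t}
      \<le> 2 * exp (- 2 * t\<^sup>2 / (L2_set w I * (b - a))\<^sup>2)"
    using Hoeffding_ineq_abs_ge[OF t0] assms(4,5) unfolding D mean by (simp add: S_def)
  also have "- 2 * t\<^sup>2 / (L2_set w I * (b - a))\<^sup>2 = - ln (2 / \<delta>)"
    unfolding t2 using assms(4,5) by (simp add: field_simps)
  also have "2 * exp (- ln (2 / \<delta>)) = \<delta>"
    using \<delta> by (simp add: exp_minus)
  finally have "1 - \<delta> \<le> 1 - measure_pmf.prob P {x. \<bar>S x - measure_pmf.expectation P S\<bar> \<ge> t}"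
    by simp
  \<comment> \<open>The tail event includes deviation exactly \<open>t\<close>, so its complement is
    the strict event, which lies inside the event with \<le>.\<close>
  also have "\<dots> = measure_pmf.prob P (UNIV - {x. \<bar>S x - measure_pmf.expectation P S\<bar> \<ge> t})"
    using measure_pmf.prob_compl[of "{x. \<bar>S x - measure_pmf.expectation P S\<bar> \<ge> t}"] by simp
  also have "\<dots> \<le> measure_pmf.prob P {x. \<bar>S x - measure_pmf.expectation P S\<bar> \<le> t}"
    by (intro measure_pmf.finite_measure_mono) auto
  finally show "measure_pmf.prob P {x. \<bar>S x - measure_pmf.expectation P S\<bar>
      \<le> L2_set w I * (b - a) * sqrt (ln (2 / \<delta>) / 2)} \<ge> 1 - \<delta>"
    unfolding t_def .
qed

text \<open>This interval has length \<open>1 + mech_beta \<epsilon>\<close>, the source of that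
  factor in the final bound.\<close>

lemma set_noise_pmf_subset: "set_pmf (noise_pmf \<epsilon> s p \<omega>) \<subseteq> {- mech_beta \<epsilon>..1}"
proof -
  have "0 < mech_beta \<epsilon>"
    by (simp add: mech_beta_def)
  then show ?thesis
    by (auto simp: noise_pmf_def)
qed

theorem theorem3:
  fixes \<delta> \<epsilon> :: real and n \<omega> :: nat
    and s :: "real \<Rightarrow> nat \<Rightarrow> real" and p m :: "nat \<Rightarrow> real"
  assumes "0 < \<delta>" and "\<delta> \<le> 1" and "\<epsilon> > 0" and "n > 0"
    and "\<forall>q\<in>{0..1}. \<forall>w\<in>{0, 1}. s q w \<in> {0..1}"
    and "strictly_proper s"
    and "\<omega> \<in> {0, 1}"
    and "\<forall>i\<in>{1..n}. p i \<in> {0..1}"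
    and "\<forall>i\<in>{1..n}. m i \<ge> 0"
    and "\<exists>i\<in>{1..n}. m i \<noteq> 0"
  shows "measure_pmf.prob (private_wagering n \<epsilon> s p m \<omega>)
           {x. \<forall>i\<in>{1..n}.
              \<bar>x i - measure_pmf.expectation (private_wagering n \<epsilon> s p m \<omega>) (\<lambda>y. y i)\<bar>
                \<le> m i * (L2_set m {1..n} / (\<Sum>j=1..n. \<bar>m j\<bar>) * (1 + mech_beta \<epsilon>)
                           * sqrt (ln (2 / \<delta>) / 2))}
         \<ge> 1 - \<delta>"
proof -
  define P where "P = Pi_pmf {1..n} 0 (\<lambda>j. noise_pmf \<epsilon> s (p j) \<omega>)"
  define S where "S = (\<lambda>x. \<Sum>j=1..n. m j * x j)"
  define M where "M = (\<Sum>j=1..n. m j)"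
  define t where "t = L2_set m {1..n} * (1 + mech_beta \<epsilon>) * sqrt (ln (2 / \<delta>) / 2)"
  have "L2_set m {1..n} \<noteq> 0"
    using assms(10) by (subst L2_set_eq_0_iff) auto
  then have L2: "L2_set m {1..n} > 0"
    using L2_set_nonneg[of m "{1..n}"] by linarith
  have "0 < mech_beta \<epsilon>"
    by (simp add: mech_beta_def)
  then have \<beta>: "- mech_beta \<epsilon> < 1"
    by simp
  have M: "M > 0"
    unfolding M_def by (metis assms(9,10) finite_atLeastAtMost order_le_less sum_pos2)
  \<comment> \<open>For nonnegative wagers the l1 norm is the total wager by which the mechanism
    divides.\<close>
  have abs_M: "(\<Sum>j=1..n. \<bar>m j\<bar>) = M"
    unfolding M_def by (intro sum.cong) (use assms(9) in auto)
  have int: "integrable (measure_pmf P) S"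
    and prob: "1 - \<delta> \<le> measure_pmf.prob P {x. \<bar>S x - measure_pmf.expectation P S\<bar> \<le> t}"
    using Hoeffding_weighted_Pi_pmf[where q = "\<lambda>j. noise_pmf \<epsilon> s (p j) \<omega>" and d = 0,
        OF finite_atLeastAtMost set_noise_pmf_subset _ L2 \<beta> assms(1,2)] assms(9)
    by (auto simp: P_def S_def t_def)
  have profit: "profit n \<epsilon> s p m \<omega> x i = m i * (mech_alpha \<epsilon> * s (p i) \<omega> - S x / M)" for x i
    by (simp add: profit_def S_def M_def)
  \<comment> \<open>A profit is affine in \<open>S\<close>, so integrability of \<open>S\<close>
    lets the expectation pass inside.\<close>
  have mean: "measure_pmf.expectation (private_wagering n \<epsilon> s p m \<omega>) (\<lambda>y. y i)
      = m i * (mech_alpha \<epsilon> * s (p i) \<omega> - measure_pmf.expectation P S / M)" for i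
    unfolding private_wagering_def integral_map_pmf profit P_def[symmetric]
    using int by simp
  \<comment> \<open>The score term is deterministic and cancels, leaving the deviation of
    \<open>S\<close> scaled by \<open>m i / M\<close>. The hypothesis on \<open>x\<close> does not
    mention \<open>i\<close>, so no union bound over bettors arises.\<close>
  have dev: "\<bar>profit n \<epsilon> s p m \<omega> x i -
        measure_pmf.expectation (private_wagering n \<epsilon> s p m \<omega>) (\<lambda>y. y i)\<bar> \<le> m i * (t / M)"
    if x: "\<bar>S x - measure_pmf.expectation P S\<bar> \<le> t" and i: "i \<in> {1..n}" for x i
  proof -
    have "profit n \<epsilon> s p m \<omega> x i -
        measure_pmf.expectation (private_wagering n \<epsilon> s p m \<omega>) (\<lambda>y. y i)
        = m i * ((measure_pmf.expectation P S - S x) / M)"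
      unfolding mean profit by (simp add: algebra_simps diff_divide_distrib)
    also have "\<bar>\<dots>\<bar> = m i * (\<bar>S x - measure_pmf.expectation P S\<bar> / M)"
      using M assms(9) i by (simp add: abs_mult abs_minus_commute)
    also have "\<dots> \<le> m i * (t / M)"
      using M assms(9) i x by (intro mult_left_mono divide_right_mono) auto
    finally show ?thesis .
  qed
  have bound: "L2_set m {1..n} / (\<Sum>j=1..n. \<bar>m j\<bar>) * (1 + mech_beta \<epsilon>)
      * sqrt (ln (2 / \<delta>) / 2) = t / M"
    unfolding abs_M by (simp add: t_def)
  have prob_private_wagering: "measure_pmf.prob (private_wagering n \<epsilon> s p m \<omega>) A
      = measure_pmf.prob P (profit n \<epsilon> s p m \<omega> -` A)" for A
    by (simp add: private_wagering_def P_def)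
  note prob
  \<comment> \<open>By \<open>dev\<close>, the one concentration event for \<open>S\<close> is
    contained in the preimage of the event for all bettors at once.\<close>
  also have "measure_pmf.prob P {x. \<bar>S x - measure_pmf.expectation P S\<bar> \<le> t}
      \<le> measure_pmf.prob P (profit n \<epsilon> s p m \<omega> -` {x. \<forall>i\<in>{1..n}.
          \<bar>x i - measure_pmf.expectation (private_wagering n \<epsilon> s p m \<omega>) (\<lambda>y. y i)\<bar>
            \<le> m i * (t / M)})"
    by (intro measure_pmf.finite_measure_mono) (use dev in auto)
  also have "\<dots> = measure_pmf.prob (private_wagering n \<epsilon> s p m \<omega>) {x. \<forall>i\<in>{1..n}.
          \<bar>x i - measure_pmf.expectation (private_wagering n \<epsilon> s p m \<omega>) (\<lambda>y. y i)\<bar>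
            \<le> m i * (t / M)}"
    by (rule prob_private_wagering[symmetric])
  finally show ?thesis
    unfolding bound .
qed

end
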